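(* Let $n\ge1$ be an integer, let $\mathbb{R}^3_{F_h}$ be the magnetic space for the polynomial $F_h(x):=1-2x^{2n+1}$, and let $c(t)$ be the homoclinic $\mathbb{R}^3_{F_h}$-geodesic corresponding to $F_h(x)$. Then $c(t)$ is not a metric line in $\mathbb{R}^3_{F_h}$.
   Context: **Magnetic space.** For a polynomial $F(x)$, $\mathbb{R}^3_F$ is $\mathbb{R}^3$ with coordinates $(x,y,z)$, the rank-2 distribution $\mathcal{D}_F=\ker(dz-F(x)\,dy)$ and the sub-Riemannian metric $(dx^2+dy^2)|_{\mathcal{D}_F}$. The sub-Riemannian distance is the infimum of lengths of absolutely continuous curves tangent to $\mathcal{D}_F$. **$\mathbb{R}^3_F$-geodesics.** An $\mathbb{R}^3_F$-geodesic (parametrized by arc length) is a curve $c(t)=(x(t),y(t),z(t))$ that is the projection of a solution of Hamilton's equations of $\frac12p_x^2+\frac12(p_y+F(x)p_z)^2$ with energy $\frac12$. The momenta $p_y=a$, $p_z=b$ are constant, and with $G=a+bF$ (the polynomial of the geodesic) $x(t)$ solves the Hamiltonian system $\frac12p_x^2+\frac12G^2(x)$ with energy $\frac12$, and $\dot y=G(x(t))$, $\dot z=G(x(t))F(x(t))$. The geodesic corresponding to $F$ is the one with $(a,b)=(0,1)$, i.e. $G=F$. **Homoclinic.** A hill interval of $G$ is a closed interval $I$ with $|G|<1$ in its interior and $|G|=1$ on its boundary. The geodesic is homoclinic if $x(t)$ is a (non-constant) homoclinic orbit of the reduced system in a compact hill interval $I=[x_0,x_1]$, which occurs exactly when one endpoint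 of $I$ is a regular point of $G$ and the other is a critical point of $G$. For $G=F_h=1-2x^{2n+1}$ the hill interval is $[0,1]$, and the homoclinic geodesic is unique up to translations in $t$, $y$ and $z$. **Metric line.** A geodesic $c:\mathbb{R}\to M$ is a metric line if $|s-t|=\mathrm{dist}_M(c(s),c(t))$ for every compact interval $[s,t]\subset\mathbb{R}$. *)

theory Defs
  imports "HOL-Analysis.Analysis" "HOL-Computational_Algebra.Polynomial"
begin

section \<open>Absolutely continuous curves\<close>

(* For a real interval k, Inf k and Sup k are its endpoints; the elements of a division
   are nonempty compact intervals with pairwise disjoint interiors. *)
definition absolutely_continuous_on :: "real set \<Rightarrow> (real \<Rightarrow> 'a::metric_space) \<Rightarrow> bool" where
  "absolutely_continuous_on S f \<longleftrightarrow>
     (\<forall>\<epsilon>>0. \<exists>\<delta>>0. \<forall>\<D> T. \<D> division_of T \<and> T \<subseteq> S \<and> (\<Sum>k\<in>\<D>. Sup k - Inf k) < \<delta>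
        \<longrightarrow> (\<Sum>k\<in>\<D>. dist (f (Inf k)) (f (Sup k))) < \<epsilon>)"

section \<open>The sub-Riemannian structure on \<open>\<real>\<^sup>3\<close> given by a polynomial\<close>

type_synonym point3 = "real \<times> real \<times> real"

(* The plane ker (dz - F(x) dy) at the point q = (x,y,z). *)
definition magnetic_distribution :: "real poly \<Rightarrow> point3 \<Rightarrow> point3 set" where
  "magnetic_distribution F q = {(u, v, w). w - poly F (fst q) * v = 0}"

(* The norm of a horizontal vector for the metric dx^2 + dy^2. *)
definition horizontal_norm :: "point3 \<Rightarrow> real" where
  "horizontal_norm = (\<lambda>(u, v, w). sqrt (u\<^sup>2 + v\<^sup>2))"

definition horizontal_curve :: "real poly \<Rightarrow> real \<Rightarrow> real \<Rightarrow> (real \<Rightarrow> point3) \<Rightarrow> bool" where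
  "horizontal_curve F a b \<gamma> \<longleftrightarrow>
     absolutely_continuous_on {a..b} \<gamma> \<and>
     (AE t in lebesgue. t \<in> {a..b} \<longrightarrow>
        (\<exists>v \<in> magnetic_distribution F (\<gamma> t). (\<gamma> has_vector_derivative v) (at t)))"

(* The integral is the Henstock-Kurzweil one, which for an absolutely continuous curve is the
   Lebesgue integral of the speed and ignores the null set where \<gamma> is not differentiable. *)
definition curve_length :: "real \<Rightarrow> real \<Rightarrow> (real \<Rightarrow> point3) \<Rightarrow> real" where
  "curve_length a b \<gamma> = integral {a..b} (\<lambda>t. horizontal_norm (vector_derivative \<gamma> (at t)))"

(* Extended-real valued, so that points not joined by a horizontal curve have distance \<infinity>. *)
definition magnetic_dist :: "real poly \<Rightarrow> point3 \<Rightarrow> point3 \<Rightarrow> ereal" where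
  "magnetic_dist F p q =
     Inf {ereal (curve_length a b \<gamma>) | a b \<gamma>.
            a \<le> b \<and> horizontal_curve F a b \<gamma> \<and> \<gamma> a = p \<and> \<gamma> b = q}"

definition metric_line :: "real poly \<Rightarrow> (real \<Rightarrow> point3) \<Rightarrow> bool" where
  "metric_line F c \<longleftrightarrow> (\<forall>s t. s \<le> t \<longrightarrow> ereal \<bar>s - t\<bar> = magnetic_dist F (c s) (c t))"

section \<open>Hamiltonian systems\<close>

(* q' = dH/dp and p' = -dH/dq, the gradient of H at (q,p) being (dH/dq, dH/dp). *)
definition hamilton_solution ::
    "('a::real_inner \<times> 'a \<Rightarrow> real) \<Rightarrow> (real \<Rightarrow> 'a) \<Rightarrow> (real \<Rightarrow> 'a) \<Rightarrow> bool" where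
  "hamilton_solution H q p \<longleftrightarrow>
     (\<forall>t. \<exists>Hq Hp. GDERIV H (q t, p t) :> (Hq, Hp) \<and>
        (q has_vector_derivative Hp) (at t) \<and> (p has_vector_derivative - Hq) (at t))"

definition hamilton_equilibrium :: "('a::real_inner \<times> 'a \<Rightarrow> real) \<Rightarrow> 'a \<times> 'a \<Rightarrow> bool" where
  "hamilton_equilibrium H e \<longleftrightarrow> GDERIV H e :> 0"

definition homoclinic_orbit ::
    "('a::real_inner \<times> 'a \<Rightarrow> real) \<Rightarrow> (real \<Rightarrow> 'a) \<Rightarrow> (real \<Rightarrow> 'a) \<Rightarrow> bool" where
  "homoclinic_orbit H q p \<longleftrightarrow>
     hamilton_solution H q p \<and> \<not> (\<lambda>t. (q t, p t)) constant_on UNIV \<and>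
     (\<exists>e. hamilton_equilibrium H e \<and>
        ((\<lambda>t. (q t, p t)) \<longlongrightarrow> e) at_top \<and> ((\<lambda>t. (q t, p t)) \<longlongrightarrow> e) at_bot)"

section \<open>Geodesics\<close>

definition magnetic_hamiltonian :: "real poly \<Rightarrow> point3 \<times> point3 \<Rightarrow> real" where
  "magnetic_hamiltonian F =
     (\<lambda>((x, y, z), (px, py, pz)). 1/2 * px\<^sup>2 + 1/2 * (py + poly F x * pz)\<^sup>2)"

(* Arc-length geodesics with constant momenta p_y = a and p_z = b. *)
definition magnetic_geodesic :: "real poly \<Rightarrow> real \<Rightarrow> real \<Rightarrow> (real \<Rightarrow> point3) \<Rightarrow> bool" where
  "magnetic_geodesic F a b c \<longleftrightarrow>
     (\<exists>p. hamilton_solution (magnetic_hamiltonian F) c p \<and>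
        (\<forall>t. magnetic_hamiltonian F (c t, p t) = 1/2) \<and>
        (\<forall>t. fst (snd (p t)) = a \<and> snd (snd (p t)) = b))"

definition geodesic_poly :: "real poly \<Rightarrow> real \<Rightarrow> real \<Rightarrow> real poly" where
  "geodesic_poly F a b = [:a:] + smult b F"

definition reduced_hamiltonian :: "real poly \<Rightarrow> real \<times> real \<Rightarrow> real" where
  "reduced_hamiltonian G = (\<lambda>(x, px). 1/2 * px\<^sup>2 + 1/2 * (poly G x)\<^sup>2)"

definition hill_interval :: "real poly \<Rightarrow> real set \<Rightarrow> bool" where
  "hill_interval G I \<longleftrightarrow>
     is_interval I \<and> closed I \<and>
     (\<forall>x \<in> interior I. \<bar>poly G x\<bar> < 1) \<and> (\<forall>x \<in> frontier I. \<bar>poly G x\<bar> = 1)"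

definition homoclinic_geodesic :: "real poly \<Rightarrow> real \<Rightarrow> real \<Rightarrow> (real \<Rightarrow> point3) \<Rightarrow> bool" where
  "homoclinic_geodesic F a b c \<longleftrightarrow>
     magnetic_geodesic F a b c \<and>
     (let G = geodesic_poly F a b; x = (\<lambda>t. fst (c t)) in
       \<exists>x0 x1 px. x0 < x1 \<and> hill_interval G {x0..x1} \<and> (\<forall>t. x t \<in> {x0..x1}) \<and>
         (\<forall>t. reduced_hamiltonian G (x t, px t) = 1/2) \<and>
         homoclinic_orbit (reduced_hamiltonian G) x px)"

definition F_h :: "nat \<Rightarrow> real poly" where
  "F_h n = 1 - monom 2 (2 * n + 1)"

end

theory Submission
  imports Defs
begin

text \<open>
  Along the homoclinic geodesic \<open>y' = F(x)\<close> and \<open>z' = F(x)\<^sup>2\<close>, while \<open>x\<close> leaves the critical point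
  \<open>0\<close> of \<open>F\<close>, where \<open>F = 1\<close>, and returns to it. Since \<open>F(x) \<le> 1\<close> along the orbit, with strict
  inequality somewhere, the geodesic advances in the \<open>y\<close> direction by less than its length: over
  \<open>[-T, T]\<close> it loses \<open>2T - \<Delta>y \<ge> \<kappa>\<close>, with \<open>\<kappa> > 0\<close> independent of large \<open>T\<close>
  (\<open>symmetric_increment_bounded_below\<close>). As \<open>y'\<close> and \<open>z'\<close> both tend to \<open>1\<close>, the quotient
  \<open>\<Delta>z / \<Delta>y\<close> tends to \<open>1\<close> (\<open>symmetric_increment_average\<close>).

  A competitor with the same end points can avoid this loss: move in the \<open>x\<close> direction to a point
  \<open>w\<close> with \<open>F(w) = \<Delta>z / \<Delta>y\<close>, then straight in the \<open>y\<close> direction by \<open>\<Delta>y\<close> at constant \<open>x = w\<close>, so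
  that \<open>z\<close> changes by \<open>F(w) \<Delta>y = \<Delta>z\<close>, and finally on to \<open>x(T)\<close> in the \<open>x\<close> direction. Its length is
  \<open>\<Delta>y + |w - x(-T)| + |x(T) - w|\<close> (\<open>magnetic_dist_le_detour\<close>). The exponent \<open>2n + 1\<close> being odd,
  \<open>F\<close> maps every neighbourhood of \<open>0\<close> onto a neighbourhood of \<open>1\<close>, whether \<open>\<Delta>z / \<Delta>y\<close> lies above
  or below \<open>1\<close>; hence \<open>w\<close> can be chosen with \<open>w \<rightarrow> 0\<close> as \<open>T \<rightarrow> \<infinity>\<close>. The two excursions in \<open>x\<close>
  then cost less than \<open>\<kappa>\<close> for large \<open>T\<close>, and the competitor is strictly shorter than \<open>2T\<close>.
\<close>

section \<open>Polygonal horizontal curves\<close>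

lemma lipschitz_imp_absolutely_continuous_on:
  fixes f :: "real \<Rightarrow> 'a::metric_space"
  assumes "K-lipschitz_on S f"
  shows "absolutely_continuous_on S f"
  unfolding absolutely_continuous_on_def
proof (intro allI impI)
  fix \<epsilon> :: real assume "\<epsilon> > 0"
  have K: "K \<ge> 0" using assms lipschitz_on_nonneg by blast
  show "\<exists>\<delta>>0. \<forall>\<D> T. \<D> division_of T \<and> T \<subseteq> S \<and> (\<Sum>k\<in>\<D>. Sup k - Inf k) < \<delta>
        \<longrightarrow> (\<Sum>k\<in>\<D>. dist (f (Inf k)) (f (Sup k))) < \<epsilon>"
  proof (intro exI conjI allI impI)
    show "0 < \<epsilon> / (K + 1)" using \<open>\<epsilon> > 0\<close> K by simp
    fix \<D> T assume *: "\<D> division_of T \<and> T \<subseteq> S \<and> (\<Sum>k\<in>\<D>. Sup k - Inf k) < \<epsilon> / (K + 1)"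
    have k: "Inf k \<le> Sup k \<and> dist (f (Inf k)) (f (Sup k)) \<le> K * (Sup k - Inf k)" if "k \<in> \<D>" for k
    proof -
      from * that have ne: "k \<noteq> {}" and sub: "k \<subseteq> S" and "\<exists>a b. k = cbox a b"
        by (auto simp: division_of_def)
      then obtain a b where ab: "k = {a..b}" by auto
      with ne have "a \<le> b" by auto
      then have "Inf k = a" "Sup k = b" using ab by auto
      moreover have "a \<in> S" "b \<in> S" using ab \<open>a \<le> b\<close> sub by auto
      ultimately show ?thesis
        using lipschitz_onD[OF assms, of a b] \<open>a \<le> b\<close> by (simp add: dist_real_def)
    qed
    have "(\<Sum>k\<in>\<D>. dist (f (Inf k)) (f (Sup k))) \<le> (\<Sum>k\<in>\<D>. K * (Sup k - Inf k))"
      using k by (intro sum_mono) auto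
    also have "\<dots> = K * (\<Sum>k\<in>\<D>. Sup k - Inf k)" by (simp add: sum_distrib_left)
    also have "\<dots> \<le> (K + 1) * (\<Sum>k\<in>\<D>. Sup k - Inf k)"
      using k by (intro mult_right_mono sum_nonneg) auto
    also have "\<dots> < (K + 1) * (\<epsilon> / (K + 1))"
      using * K by (intro mult_strict_left_mono) auto
    also have "\<dots> = \<epsilon>" using K by simp
    finally show "(\<Sum>k\<in>\<D>. dist (f (Inf k)) (f (Sup k))) < \<epsilon>" .
  qed
qed

text \<open>
  Weighting the displacement of each segment of a polygon by a shifted ramp gives the polygon as
  one Lipschitz expression, with one segment per unit of time and no case distinction.
\<close>
definition unit_ramp :: "real \<Rightarrow> real" where
  "unit_ramp t = max 0 (min 1 t)"

lemma unit_ramp_has_real_derivative: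
  "0 < t \<Longrightarrow> t < 1 \<Longrightarrow> (unit_ramp has_real_derivative 1) (at t)"
  "t < 0 \<Longrightarrow> (unit_ramp has_real_derivative 0) (at t)"
  "t > 1 \<Longrightarrow> (unit_ramp has_real_derivative 0) (at t)"
proof -
  show "(unit_ramp has_real_derivative 1) (at t)" if "0 < t" "t < 1"
    by (rule has_field_derivative_transform_within_open[of "\<lambda>t. t" 1 t "{0<..<1}"])
       (use that in \<open>auto simp: unit_ramp_def\<close>)
  show "(unit_ramp has_real_derivative 0) (at t)" if "t < 0"
    by (rule has_field_derivative_transform_within_open[of "\<lambda>t. 0" 0 t "{..<0}"])
       (use that in \<open>auto simp: unit_ramp_def\<close>)
  show "(unit_ramp has_real_derivative 0) (at t)" if "t > 1"
    by (rule has_field_derivative_transform_within_open[of "\<lambda>t. 1" 0 t "{1<..}"])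
       (use that in \<open>auto simp: unit_ramp_def\<close>)
qed

lemma unit_ramp_lipschitz: "\<bar>unit_ramp s - unit_ramp t\<bar> \<le> \<bar>s - t\<bar>"
  by (auto simp: unit_ramp_def)

text \<open>
  The horizontal polygon on \<open>[0, 3]\<close> that starts at \<open>(x0, y0, z0)\<close>, whose projection to the
  \<open>(x, y)\<close> plane goes from \<open>x0\<close> to \<open>w\<close>, then by \<open>h\<close> in the \<open>y\<close> direction, then from \<open>w\<close> to \<open>x1\<close>.
  Being horizontal forces the third component of each segment.
\<close>
definition detour :: "real poly \<Rightarrow> real \<Rightarrow> real \<Rightarrow> real \<Rightarrow> real \<Rightarrow> real \<Rightarrow> real \<Rightarrow> real \<Rightarrow> point3" where
  "detour F x0 y0 z0 w h x1 t =
     (x0, y0, z0) + unit_ramp t *\<^sub>R (w - x0, 0, 0)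
       + unit_ramp (t - 1) *\<^sub>R (0, h, poly F w * h) + unit_ramp (t - 2) *\<^sub>R (x1 - w, 0, 0)"

lemma detour_has_vector_derivative:
  assumes "t \<in> {0<..<3} - {1, 2}"
  shows "(detour F x0 y0 z0 w h x1 has_vector_derivative
           (if t < 1 then (w - x0, 0, 0) else if t < 2 then (0, h, poly F w * h)
            else (x1 - w, 0, 0))) (at t)"
proof -
  have D: "(detour F x0 y0 z0 w h x1 has_vector_derivative
       a *\<^sub>R (w - x0, 0, 0) + b *\<^sub>R (0, h, poly F w * h) + c *\<^sub>R (x1 - w, 0, 0)) (at t)"
    if "(unit_ramp has_real_derivative a) (at t)" "(unit_ramp has_real_derivative b) (at (t - 1))"
       "(unit_ramp has_real_derivative c) (at (t - 2))" for a b c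
  proof -
    have b: "((\<lambda>t. unit_ramp (t - 1)) has_real_derivative b) (at t)"
      and c: "((\<lambda>t. unit_ramp (t - 2)) has_real_derivative c) (at t)"
      using that(2,3) DERIV_shift[THEN iffD1, of unit_ramp _ t "-1"]
        DERIV_shift[THEN iffD1, of unit_ramp _ t "-2"]
      unfolding add_uminus_conv_diff by blast+
    have "((\<lambda>t. (x0, y0, z0) + unit_ramp t *\<^sub>R (w - x0, 0, 0)
       + unit_ramp (t - 1) *\<^sub>R (0, h, poly F w * h) + unit_ramp (t - 2) *\<^sub>R (x1 - w, 0, 0))
       has_vector_derivative
       0 + (unit_ramp t *\<^sub>R 0 + a *\<^sub>R (w - x0, 0, 0))
         + (unit_ramp (t - 1) *\<^sub>R 0 + b *\<^sub>R (0, h, poly F w * h))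
         + (unit_ramp (t - 2) *\<^sub>R 0 + c *\<^sub>R (x1 - w, 0, 0))) (at t)"
      by (intro has_vector_derivative_add has_vector_derivative_scaleR has_vector_derivative_const
            that(1) b c)
    then show ?thesis
      by (simp only: detour_def[abs_def] add_0_left scaleR_zero_right)
  qed
  consider "0 < t \<and> t < 1" | "1 < t \<and> t < 2" | "2 < t \<and> t < 3" using assms by force
  then show ?thesis
  proof cases
    case 1
    then show ?thesis using D[OF unit_ramp_has_real_derivative(1,2,2)] by simp
  next
    case 2
    then show ?thesis using D[OF unit_ramp_has_real_derivative(3,1,2)] by simp
  next
    case 3
    then show ?thesis using D[OF unit_ramp_has_real_derivative(3,3,1)] by simp
  qed
qed

lemma detour_endpoints:
  "detour F x0 y0 z0 w h x1 0 = (x0, y0, z0)"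
  "detour F x0 y0 z0 w h x1 3 = (x1, y0 + h, z0 + poly F w * h)"
  by (auto simp: detour_def unit_ramp_def)

lemma detour_lipschitz: "\<exists>K. K-lipschitz_on S (detour F x0 y0 z0 w h x1)"
proof -
  have s: "(norm v)-lipschitz_on S (\<lambda>t. unit_ramp (t - a) *\<^sub>R v)" for a and v :: point3
  proof (intro lipschitz_onI)
    fix s t assume "s \<in> S" "t \<in> S"
    have "dist (unit_ramp (s - a) *\<^sub>R v) (unit_ramp (t - a) *\<^sub>R v)
        = \<bar>unit_ramp (s - a) - unit_ramp (t - a)\<bar> * norm v"
      by (simp add: dist_norm flip: scaleR_diff_left)
    also have "\<dots> \<le> norm v * dist s t"
      using unit_ramp_lipschitz[of "s - a" "t - a"]
      by (simp add: dist_real_def mult.commute mult_left_mono)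
    finally show "dist (unit_ramp (s - a) *\<^sub>R v) (unit_ramp (t - a) *\<^sub>R v) \<le> norm v * dist s t" .
  qed simp
  show ?thesis
    unfolding detour_def[abs_def]
    by (rule exI, rule lipschitz_on_add, rule lipschitz_on_add, rule lipschitz_on_add,
        rule lipschitz_on_constant, rule s[where a = 0, unfolded diff_zero], rule s, rule s)
qed

text \<open>
  Only the middle segment moves in \<open>y\<close>, and there \<open>x\<close> is frozen at \<open>w\<close>, so the slope \<open>F w\<close> of that
  segment is the slope of the distribution.
\<close>
lemma detour_horizontal: "horizontal_curve F 0 3 (detour F x0 y0 z0 w h x1)"
proof -
  let ?\<gamma> = "detour F x0 y0 z0 w h x1"
  have "AE t in lebesgue. t \<notin> {0, 1, 2, 3::real}"
    by (intro AE_not_in) (simp add: negligible_iff_null_sets[symmetric])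
  moreover have "\<exists>v \<in> magnetic_distribution F (?\<gamma> t). (?\<gamma> has_vector_derivative v) (at t)"
    if "t \<notin> {0, 1, 2, 3}" "t \<in> {0..3}" for t
  proof -
    have "t \<in> {0<..<3} - {1, 2}" using that by auto
    moreover have "fst (?\<gamma> t) = w" if "1 < t" "t < 2"
      using that by (simp add: detour_def unit_ramp_def)
    ultimately show ?thesis
      using detour_has_vector_derivative[of t F x0 y0 z0 w h x1] that
      by (intro bexI[where x = "if t < 1 then (w - x0, 0, 0) else if t < 2 then (0, h, poly F w * h)
            else (x1 - w, 0, 0)"]) (auto simp: magnetic_distribution_def)
  qed
  ultimately have "AE t in lebesgue. t \<in> {0..3} \<longrightarrow>
     (\<exists>v \<in> magnetic_distribution F (?\<gamma> t). (?\<gamma> has_vector_derivative v) (at t))"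
    by - (erule eventually_mono, blast)
  then show ?thesis
    unfolding horizontal_curve_def
    using detour_lipschitz lipschitz_imp_absolutely_continuous_on by blast
qed

lemma detour_length:
  "curve_length 0 3 (detour F x0 y0 z0 w h x1) = \<bar>w - x0\<bar> + \<bar>h\<bar> + \<bar>x1 - w\<bar>"
proof -
  let ?f = "\<lambda>t. horizontal_norm (vector_derivative (detour F x0 y0 z0 w h x1) (at t))"
  have v: "?f t = (if t < 1 then \<bar>w - x0\<bar> else if t < 2 then \<bar>h\<bar> else \<bar>x1 - w\<bar>)"
    if "t \<in> {0<..<3} - {1, 2}" for t
    using vector_derivative_at[OF detour_has_vector_derivative[OF that, of F x0 y0 z0 w h x1]]
    by (simp add: horizontal_norm_def)
  have piece: "(?f has_integral l) {a..a + 1}"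
    if "\<And>t. t \<in> {a<..<a + 1} \<Longrightarrow> ?f t = l" for a l :: real
  proof (rule has_integral_spike_finite[of "{a, a + 1}"])
    show "((\<lambda>t. l) has_integral l) {a..a + 1}"
      using has_integral_const_real[of l a "a + 1"] by simp
    show "?f t = l" if "t \<in> {a..a + 1} - {a, a + 1}" for t
      using that by (intro \<open>\<And>t. t \<in> {a<..<a + 1} \<Longrightarrow> ?f t = l\<close>) auto
  qed simp
  have "?f t = \<bar>w - x0\<bar>" if "t \<in> {0<..<0 + 1}" for t
    using that by (subst v) auto
  from piece[of 0, OF this] have 1: "(?f has_integral \<bar>w - x0\<bar>) {0..1}" by simp
  have "?f t = \<bar>h\<bar>" if "t \<in> {1<..<1 + 1}" for t
    using that by (subst v) auto
  from piece[of 1, OF this] have 2: "(?f has_integral \<bar>h\<bar>) {1..2}" by simp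
  have "?f t = \<bar>x1 - w\<bar>" if "t \<in> {2<..<2 + 1}" for t
    using that by (subst v) auto
  from piece[of 2, OF this] have 3: "(?f has_integral \<bar>x1 - w\<bar>) {2..3}" by simp
  have "(?f has_integral \<bar>w - x0\<bar> + \<bar>h\<bar> + \<bar>x1 - w\<bar>) {0..3}"
    by (rule has_integral_combine[OF _ _ has_integral_combine[OF _ _ 1 2] 3]) auto
  then show ?thesis
    unfolding curve_length_def by (rule integral_unique)
qed

text \<open>
  The third coordinate of the end point shows how the choice of \<open>w\<close> controls the displacement in
  \<open>z\<close>; this is the upper bound on distances that beats the geodesic.
\<close>
lemma magnetic_dist_le_detour:
  "magnetic_dist F (x0, y0, z0) (x1, y0 + h, z0 + poly F w * h)
     \<le> ereal (\<bar>w - x0\<bar> + \<bar>h\<bar> + \<bar>x1 - w\<bar>)"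
  unfolding magnetic_dist_def
proof (rule Inf_lower, rule CollectI)
  show "\<exists>a b \<gamma>. ereal (\<bar>w - x0\<bar> + \<bar>h\<bar> + \<bar>x1 - w\<bar>) = ereal (curve_length a b \<gamma>) \<and>
      a \<le> b \<and> horizontal_curve F a b \<gamma> \<and> \<gamma> a = (x0, y0, z0) \<and>
      \<gamma> b = (x1, y0 + h, z0 + poly F w * h)"
    by (rule exI[of _ 0], rule exI[of _ 3], rule exI[of _ "detour F x0 y0 z0 w h x1"])
       (simp add: detour_horizontal detour_endpoints detour_length)
qed

section \<open>The equations of motion\<close>

lemma has_derivative_poly_compose:
  fixes g :: "'a::real_normed_vector \<Rightarrow> real"
  assumes "(g has_derivative g') (at q within S)"
  shows "((\<lambda>q. poly G (g q)) has_derivative (\<lambda>h. g' h * poly (pderiv G) (g q))) (at q within S)"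
  using DERIV_compose_FDERIV[OF poly_DERIV assms] .

lemma GDERIV_reduced_hamiltonian:
  "GDERIV (reduced_hamiltonian G) (x, p) :> (poly G x * poly (pderiv G) x, p)"
proof -
  have "((\<lambda>q. 1/2 * (snd q)\<^sup>2 + 1/2 * (poly G (fst q))\<^sup>2) has_derivative
      (\<lambda>h. snd h * p + fst h * (poly G x * poly (pderiv G) x))) (at (x, p))"
    by (rule derivative_eq_intros has_derivative_poly_compose refl)+ (simp add: algebra_simps fun_eq_iff)
  then show ?thesis
    by (simp add: gderiv_def reduced_hamiltonian_def case_prod_beta' inner_prod_def add.commute)
qed

lemma GDERIV_magnetic_hamiltonian:
  "GDERIV (magnetic_hamiltonian F) ((x, y, z), (px, py, pz)) :>
     (((py + poly F x * pz) * (poly (pderiv F) x * pz), 0, 0),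
      (px, py + poly F x * pz, (py + poly F x * pz) * poly F x))"
proof -
  have "((\<lambda>q. 1/2 * (fst (snd q))\<^sup>2 + 1/2 * (fst (snd (snd q)) + poly F (fst (fst q)) * snd (snd (snd q)))\<^sup>2)
     has_derivative (\<lambda>h. fst (fst h) * ((py + poly F x * pz) * (poly (pderiv F) x * pz))
       + (fst (snd h) * px + (fst (snd (snd h)) * (py + poly F x * pz)
       + snd (snd (snd h)) * ((py + poly F x * pz) * poly F x))))) (at ((x, y, z), (px, py, pz)))"
    by (rule derivative_eq_intros has_derivative_poly_compose refl)+ (simp add: algebra_simps fun_eq_iff)
  then show ?thesis
    by (simp add: gderiv_def magnetic_hamiltonian_def case_prod_beta' inner_prod_def)
qed

text \<open>
  Solutions of Hamilton's equations are given with unspecified gradients; uniqueness identifies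
  these with the explicit ones above.
\<close>
lemma GDERIV_unique:
  assumes "GDERIV f x :> D" "GDERIV f x :> D'"
  shows "D = D'"
proof -
  have "(\<lambda>h. h \<bullet> D) = (\<lambda>h. h \<bullet> D')"
    using assms unfolding gderiv_def by (rule has_derivative_unique)
  then have "(D - D') \<bullet> (D - D') = 0" by (metis inner_diff_right right_minus_eq)
  then show ?thesis by simp
qed

lemma reduced_hamilton_solutionD:
  assumes "hamilton_solution (reduced_hamiltonian G) x p"
  shows "(x has_real_derivative p t) (at t)"
proof -
  obtain Hq Hp where "GDERIV (reduced_hamiltonian G) (x t, p t) :> (Hq, Hp)"
    "(x has_vector_derivative Hp) (at t)"
    using assms unfolding hamilton_solution_def by blast
  with GDERIV_unique[OF this(1) GDERIV_reduced_hamiltonian] show ?thesis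
    by (simp add: has_real_derivative_iff_has_vector_derivative)
qed

lemma magnetic_geodesic_velocity:
  assumes "magnetic_geodesic F a b c"
  defines "G \<equiv> geodesic_poly F a b"
  shows "((\<lambda>t. fst (snd (c t))) has_real_derivative poly G (fst (c t))) (at t)"
    and "((\<lambda>t. snd (snd (c t))) has_real_derivative
            poly G (fst (c t)) * poly F (fst (c t))) (at t)"
proof -
  obtain p where p: "hamilton_solution (magnetic_hamiltonian F) c p"
    "\<And>t. fst (snd (p t)) = a" "\<And>t. snd (snd (p t)) = b"
    using assms by (auto simp: magnetic_geodesic_def)
  obtain x y z where c: "c t = (x, y, z)" by (cases "c t")
  have pt: "p t = (fst (p t), a, b)" using p(2,3)[of t] by (simp add: prod_eq_iff)
  obtain Hq Hp where H: "GDERIV (magnetic_hamiltonian F) (c t, p t) :> (Hq, Hp)"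
    "(c has_vector_derivative Hp) (at t)"
    using p(1) unfolding hamilton_solution_def by blast
  have G: "poly G x = a + poly F x * b"
    by (simp add: G_def geodesic_poly_def mult.commute)
  have "Hp = (fst (p t), poly G x, poly G x * poly F x)"
    using GDERIV_unique[OF H(1) GDERIV_magnetic_hamiltonian[of F x y z "fst (p t)" a b, folded pt c]]
    unfolding G by (simp only: prod.inject)
  with H(2) have "(c has_vector_derivative (fst (p t), poly G x, poly G x * poly F x)) (at t)" by simp
  then have v: "(c has_derivative (\<lambda>h. h *\<^sub>R (fst (p t), poly G x, poly G x * poly F x))) (at t)"
    by (simp add: has_vector_derivative_def)
  show "((\<lambda>t. fst (snd (c t))) has_real_derivative poly G (fst (c t))) (at t)"
    by (rule has_derivative_imp_has_field_derivative
          [OF has_derivative_fst[OF has_derivative_snd[OF v]]]) (simp add: c)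
  show "((\<lambda>t. snd (snd (c t))) has_real_derivative poly G (fst (c t)) * poly F (fst (c t))) (at t)"
    by (rule has_derivative_imp_has_field_derivative
          [OF has_derivative_snd[OF has_derivative_snd[OF v]]]) (simp add: c)
qed

text \<open>Since \<open>p\<close> is the velocity of \<open>x\<close>, an orbit with \<open>p = 0\<close> throughout would be constant.\<close>
lemma homoclinic_orbit_moves:
  assumes "homoclinic_orbit (reduced_hamiltonian G) x p"
  shows "\<exists>t. p t \<noteq> 0"
proof (rule ccontr)
  assume "\<not> ?thesis"
  then have p: "p t = 0" for t by blast
  have "(x has_real_derivative 0) (at t)" for t
    using reduced_hamilton_solutionD[of G x p t] assms p by (simp add: homoclinic_orbit_def)
  then have "x t = x 0" for t
    using DERIV_isconst_all by blast
  then have "(\<lambda>t. (x t, p t)) constant_on UNIV"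
    using p by (auto simp: constant_on_def)
  then show False using assms by (simp add: homoclinic_orbit_def)
qed

text \<open>
  The limit equilibrium \<open>(e, q)\<close> satisfies \<open>q = 0\<close> and \<open>G(e) G'(e) = 0\<close>. Conservation of energy
  passes to the limit and gives \<open>G(e)\<^sup>2 = 1\<close>, which rules out the factor \<open>G(e)\<close>.
\<close>
lemma homoclinic_limit_critical:
  assumes hom: "homoclinic_orbit (reduced_hamiltonian G) x p"
    and energy: "\<And>t. reduced_hamiltonian G (x t, p t) = 1/2"
  obtains e where "(x \<longlongrightarrow> e) at_top" "(x \<longlongrightarrow> e) at_bot"
    "\<bar>poly G e\<bar> = 1" "poly (pderiv G) e = 0"
proof -
  obtain e q where eq: "hamilton_equilibrium (reduced_hamiltonian G) (e, q)"
     and lims: "((\<lambda>t. (x t, p t)) \<longlongrightarrow> (e, q)) at_top" "((\<lambda>t. (x t, p t)) \<longlongrightarrow> (e, q)) at_bot"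
    using hom by (auto simp: homoclinic_orbit_def)
  have crit: "poly G e * poly (pderiv G) e = 0" "q = 0"
    using eq GDERIV_unique[OF _ GDERIV_reduced_hamiltonian[of G e q], of 0]
    by (auto simp: hamilton_equilibrium_def zero_prod_def)
  have "((\<lambda>t. 1/2 * (p t)\<^sup>2 + 1/2 * (poly G (x t))\<^sup>2) \<longlongrightarrow> 1/2 * q\<^sup>2 + 1/2 * (poly G e)\<^sup>2) at_top"
    using tendsto_fst[OF lims(1)] tendsto_snd[OF lims(1)] by (auto intro!: tendsto_intros)
  moreover have "(\<lambda>t. 1/2 * (p t)\<^sup>2 + 1/2 * (poly G (x t))\<^sup>2) = (\<lambda>t. 1/2)"
    using energy by (simp add: reduced_hamiltonian_def fun_eq_iff)
  ultimately have "((\<lambda>t::real. 1/2) \<longlongrightarrow> 1/2 * q\<^sup>2 + 1/2 * (poly G e)\<^sup>2) at_top"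
    by metis
  then have "1/2 * q\<^sup>2 + 1/2 * (poly G e)\<^sup>2 = 1/2"
    by (simp add: tendsto_const_iff)
  then have "\<bar>poly G e\<bar> = 1" using crit by (simp add: abs_square_eq_1)
  moreover from this crit have "poly (pderiv G) e = 0" by auto
  ultimately show thesis
    using that tendsto_fst[OF lims(1)] tendsto_fst[OF lims(2)] by simp
qed

section \<open>Symmetric increments\<close>

text \<open>
  Applied to \<open>t - y(t)\<close>, this bounds from below the length that a geodesic loses against its
  displacement in \<open>y\<close>. The function is nondecreasing, and what it gains to the right of \<open>t0\<close> is
  never given back.
\<close>
lemma symmetric_increment_bounded_below:
  fixes f :: "real \<Rightarrow> real"
  assumes "\<And>t. (f has_real_derivative f' t) (at t)" "\<And>t. f' t \<ge> 0" "f' t0 > 0"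
  obtains \<kappa> where "\<kappa> > 0" "eventually (\<lambda>T. \<kappa> \<le> f T - f (- T)) at_top"
proof -
  obtain d where d: "d > 0" "\<And>h. 0 < h \<Longrightarrow> h < d \<Longrightarrow> f t0 < f (t0 + h)"
    using DERIV_pos_inc_right[OF assms(1) assms(3)] by blast
  define t1 where "t1 = t0 + d / 2"
  have mono: "f s \<le> f t" if "s \<le> t" for s t
    using DERIV_nonneg_imp_nondecreasing[OF that] assms(1,2) by blast
  show thesis
  proof
    show "f t1 - f t0 > 0" using d(2)[of "d/2"] d(1) by (simp add: t1_def)
    show "eventually (\<lambda>T. f t1 - f t0 \<le> f T - f (- T)) at_top"
      using eventually_ge_at_top[of "max t1 (- t0)"]
      by eventually_elim (smt (verit) mono)
  qed
qed

text \<open>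
  A Cesaro-type statement: by l'Hopital's rule the mean value of the derivative over \<open>[-T, T]\<close>
  inherits its limit.
\<close>
lemma symmetric_increment_average:
  fixes f :: "real \<Rightarrow> real"
  assumes "\<And>t. (f has_real_derivative f' t) (at t)" "(f' \<longlongrightarrow> l) at_top" "(f' \<longlongrightarrow> l) at_bot"
  shows "((\<lambda>T. (f T - f (- T)) / T) \<longlongrightarrow> 2 * l) at_top"
proof (rule lhospital_at_top_at_top)
  show "filterlim (\<lambda>T::real. T) at_top at_top" by (rule filterlim_ident)
  show "eventually (\<lambda>T. ((\<lambda>T. f T - f (- T)) has_real_derivative f' T + f' (- T)) (at T)) at_top"
    by (auto intro!: always_eventually derivative_eq_intros DERIV_chain2[OF assms(1)] assms(1))
  have "((\<lambda>T. f' T + f' (- T)) \<longlongrightarrow> l + l) at_top"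
    by (intro tendsto_add assms(2) filterlim_compose[OF assms(3) filterlim_uminus_at_bot_at_top])
  then show "((\<lambda>T. (f' T + f' (- T)) / 1) \<longlongrightarrow> 2 * l) at_top" by simp
qed (auto intro!: always_eventually derivative_eq_intros)

section \<open>The homoclinic geodesic can be shortened\<close>

lemma poly_F_h: "poly (F_h n) x = 1 - 2 * x ^ (2 * n + 1)"
  by (simp add: F_h_def poly_monom)

lemma F_h_critical:
  assumes "n \<ge> 1" "poly (pderiv (F_h n)) x = 0"
  shows "x = 0"
  using assms by (auto simp: F_h_def pderiv_diff pderiv_monom poly_monom)

theorem theorem41:
  fixes n :: nat and c :: "real \<Rightarrow> real \<times> real \<times> real"
  assumes "n \<ge> 1"
    and "homoclinic_geodesic (F_h n) 0 1 c"
  shows "\<not> metric_line (F_h n) c"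
proof
  assume line: "metric_line (F_h n) c"
  let ?F = "F_h n"
  define m where "m = 2 * n + 1"
  have m: "odd m" by (simp add: m_def)
  define x where "x t = fst (c t)" for t
  define y where "y t = fst (snd (c t))" for t
  define z where "z t = snd (snd (c t))" for t
  define f where "f t = poly ?F (x t)" for t
  have c: "c t = (x t, y t, z t)" for t by (simp add: x_def y_def z_def)
  have G: "geodesic_poly ?F 0 1 = ?F" by (simp add: geodesic_poly_def)
  obtain p where energy: "\<And>t. reduced_hamiltonian ?F (x t, p t) = 1/2"
    and hom: "homoclinic_orbit (reduced_hamiltonian ?F) x p"
    and geo: "magnetic_geodesic ?F 0 1 c"
    using assms(2) by (auto simp: homoclinic_geodesic_def G Let_def x_def[abs_def])
  have dy: "(y has_real_derivative f t) (at t)" for t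
    using magnetic_geodesic_velocity(1)[OF geo, of t] by (simp add: G y_def[abs_def] f_def x_def)
  have dz: "(z has_real_derivative f t * f t) (at t)" for t
    using magnetic_geodesic_velocity(2)[OF geo, of t] by (simp add: G z_def[abs_def] f_def x_def)
  have pf: "(p t)\<^sup>2 + (f t)\<^sup>2 = 1" for t
    using energy[of t] by (simp add: reduced_hamiltonian_def f_def)
  obtain e where e: "(x \<longlongrightarrow> e) at_top" "(x \<longlongrightarrow> e) at_bot" "poly (pderiv ?F) e = 0"
    using homoclinic_limit_critical[OF hom energy] by metis
  then have x0: "(x \<longlongrightarrow> 0) at_top" "(x \<longlongrightarrow> 0) at_bot"
    using F_h_critical[OF assms(1)] by blast+
  have f1: "(f \<longlongrightarrow> 1) at_top" "(f \<longlongrightarrow> 1) at_bot"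
    unfolding f_def[abs_def] using tendsto_poly[OF x0(1), of ?F] tendsto_poly[OF x0(2), of ?F]
    by (simp_all add: poly_F_h)

  \<comment> \<open>\<open>t - y(t)\<close> has derivative \<open>1 - F(x(t)) \<ge> 0\<close>, positive wherever the momentum \<open>p\<close> is nonzero.\<close>
  have fle: "f t \<le> 1" for t
  proof -
    have "(f t)\<^sup>2 \<le> 1" using pf[of t] zero_le_power2[of "p t"] by linarith
    then show ?thesis by (simp add: abs_square_le_1)
  qed
  obtain t0 where "p t0 \<noteq> 0" using homoclinic_orbit_moves[OF hom] by blast
  then have "f t0 < 1" using pf[of t0] fle[of t0] by (cases "f t0 = 1") auto
  obtain \<kappa> where \<kappa>: "\<kappa> > 0" "eventually (\<lambda>T. \<kappa> \<le> (T - y T) - (- T - y (- T))) at_top"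
    by (rule symmetric_increment_bounded_below[of "\<lambda>t. t - y t" "\<lambda>t. 1 - f t" t0])
       (use fle \<open>f t0 < 1\<close> in \<open>auto intro: DERIV_diff[OF DERIV_ident dy]\<close>)

  define A where "A T = y T - y (- T)" for T
  define B where "B T = z T - z (- T)" for T
  have A: "((\<lambda>T. A T / T) \<longlongrightarrow> 2) at_top"
    using symmetric_increment_average[OF dy f1] by (simp add: A_def)
  have B: "((\<lambda>T. B T / T) \<longlongrightarrow> 2) at_top"
    using symmetric_increment_average[OF dz, of 1]
      tendsto_mult[OF f1(1) f1(1)] tendsto_mult[OF f1(2) f1(2)]
    by (simp add: B_def)
  have "eventually (\<lambda>T. A T / T > 0) at_top"
    using order_tendstoD(1)[OF A, of 0] by simp
  then have Apos: "eventually (\<lambda>T. A T > 0) at_top"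
    using eventually_gt_at_top[of 0] by eventually_elim (simp add: zero_less_divide_iff)
  have "((\<lambda>T. (B T / T) / (A T / T)) \<longlongrightarrow> 2 / 2) at_top"
    by (intro tendsto_divide A B) simp
  moreover have "eventually (\<lambda>T. (B T / T) / (A T / T) = B T / A T) at_top"
    using eventually_gt_at_top[of 0] by eventually_elim simp
  ultimately have BA: "((\<lambda>T. B T / A T) \<longlongrightarrow> 1) at_top"
    using Lim_transform_eventually by fastforce

  \<comment> \<open>\<open>w T\<close> solves \<open>1 - 2 w\<^sup>m = B T / A T\<close>. The radicand may have either sign; as \<open>m\<close> is odd, the
    real root is a solution in both cases.\<close>
  define w where "w T = root m ((1 - B T / A T) / 2)" for T
  have "(w \<longlongrightarrow> root m ((1 - 1) / 2)) at_top"
    unfolding w_def[abs_def] by (intro tendsto_intros BA) simp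
  then have w: "(w \<longlongrightarrow> 0) at_top" by simp
  have Fw: "poly ?F (w T) * A T = B T" if "A T > 0" for T
  proof -
    have "w T ^ m = (1 - B T / A T) / 2"
      unfolding w_def using m by (rule odd_real_root_pow)
    then have "poly ?F (w T) = B T / A T"
      unfolding poly_F_h m_def[symmetric] by simp
    then show ?thesis using that by simp
  qed
  have "((\<lambda>T. \<bar>w T - x (- T)\<bar> + \<bar>x T - w T\<bar>) \<longlongrightarrow> \<bar>0 - 0\<bar> + \<bar>0 - 0\<bar>) at_top"
    by (intro tendsto_intros w x0(1) filterlim_compose[OF x0(2) filterlim_uminus_at_bot_at_top])
  then have "eventually (\<lambda>T. \<bar>w T - x (- T)\<bar> + \<bar>x T - w T\<bar> < \<kappa>) at_top"
    using \<kappa>(1) by (intro order_tendstoD(2)) auto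
  then have "eventually (\<lambda>T. T > 0 \<and> A T > 0 \<and> \<kappa> \<le> (T - y T) - (- T - y (- T)) \<and>
      \<bar>w T - x (- T)\<bar> + \<bar>x T - w T\<bar> < \<kappa>) at_top"
    using \<kappa>(2) Apos eventually_gt_at_top[of 0] by eventually_elim auto
  then obtain T where T: "T > 0" "A T > 0" "\<kappa> \<le> (T - y T) - (- T - y (- T))"
      "\<bar>w T - x (- T)\<bar> + \<bar>x T - w T\<bar> < \<kappa>"
    using eventually_happens'[OF trivial_limit_at_top_linorder] by blast
  have "c T = (x T, y (- T) + A T, z (- T) + poly ?F (w T) * A T)"
    using Fw[OF T(2)] by (simp add: c A_def B_def)
  then have "magnetic_dist ?F (c (- T)) (c T) \<le> ereal (\<bar>w T - x (- T)\<bar> + \<bar>A T\<bar> + \<bar>x T - w T\<bar>)"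
    using magnetic_dist_le_detour by (simp add: c)
  also have "\<dots> < ereal \<bar>- T - T\<bar>"
    using T by (simp add: A_def)
  also have "\<dots> = magnetic_dist ?F (c (- T)) (c T)"
    using line[unfolded metric_line_def, rule_format, of "- T" T] T(1) by simp
  finally show False by simp
qed

end
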